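(* Let $A$ be an asymmetric fuzzy number such that $[A]_1=\{a_m\}$, and let $a<b$ be real numbers. (i) If $f:[a,b]\to\mathbb{R}_{\mathcal{F}(A)}$ is differentiable almost everywhere in $[a,b]$ and is such that $$\int_a^b f(t)\odot\eta'(t)\,dt\in\mathbb{R}_{\mathcal{F}(A)}^0$$ for every $\eta\in C^1([a,b],\mathbb{R}_{\mathcal{F}(A)})$ with $\eta(a)=\eta(b)=0$, then there is $u\in\mathbb{R}_{\mathcal{F}(A)}$ such that $f(t)\ominus u\in\mathbb{R}_{\mathcal{F}(A)}^0$ for almost every $t\in[a,b]$. (ii) If $f:[a,b]\to\mathbb{R}_{\mathcal{F}(A)}$ is differentiable almost everywhere in $[a,b]$ and is such that $$\int_a^b f(t)\odot\eta'(t)\,dt=0$$ for every $\eta\in C^1([a,b],\mathbb{R}_{\mathcal{F}(A)})$ with $\eta(a)=\eta(b)=0$, then there is $u\in\mathbb{R}_{\mathcal{F}(A)}$ such that $f(t)=u$ for almost every $t\in[a,b]$.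
   Context: A fuzzy subset of $\mathbb{R}$ is a function $A:\mathbb{R}\to[0,1]$; its $\alpha$-levels are $[A]_\alpha=\{x: A(x)\geq\alpha\}$ for $0<\alpha\leq1$ and $[A]_0=\overline{\{x:A(x)>0\}}$. $A$ is a fuzzy number if all its $\alpha$-levels are nonempty closed intervals and $\{x:A(x)>0\}$ is bounded. For $r,q\in\mathbb{R}$, $r+qA$ is the fuzzy number with $[r+qA]_\alpha=\{r+qx: x\in[A]_\alpha\}$ for every $\alpha\in[0,1]$; $r+0A$ is identified with the real number $r$. $A$ is asymmetric if for every $x\in\mathbb{R}$ there exists $y\in\mathbb{R}$ with $A(x-y)\neq A(x+y)$. Put $\mathbb{R}_{\mathcal{F}(A)}=\{r+qA: r,q\in\mathbb{R}\}$. When $A$ is asymmetric, $(r,q)\mapsto r+qA$ is a bijection from $\mathbb{R}^2$ onto $\mathbb{R}_{\mathcal{F}(A)}$, and $\mathbb{R}_{\mathcal{F}(A)}$ is a 2-dimensional real vector space with $(r_B+q_BA)\oplus(r_C+q_CA)=(r_B+r_C)+(q_B+q_C)A$, $\lambda(r+qA)=\lambda r+(\lambda q)A$ and $B\ominus C=B\oplus(-1)C$, normed by $\|r+qA\|=|q|+|r+qa_m|$. $\Psi$-cross product (for $[A]_1=\{a_m\}$): for $B=r_B+q_BA$, $C=r_C+q_CA$ with $[B]_1=\{b\}$, $[C]_1=\{c\}$, $B\odot C=cB+bC-bc$ (sum in the vector space $\mathbb{R}_{\mathcal{F}(A)}$ with addition $\oplus$, i.e. $B\odot C=cB\oplus bC\oplus(-bc)$),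 equivalently $B\odot C=(r_Br_C-a_m^2q_Bq_C)+(r_Bq_C+r_Cq_B+2a_mq_Bq_C)A$. Also $B^2=B\odot B$ and $\mathbb{R}_{\mathcal{F}(A)}^0=\{B: B^2=0\}=\{r+qA: r+qa_m=0\}$. Integrals are Riemann integrals in the Banach space $\mathbb{R}_{\mathcal{F}(A)}$; $f=r(\cdot)+q(\cdot)A$ is integrable iff $r,q$ are Riemann integrable, and then $\int_a^b f=\int_a^b r+\left(\int_a^b q\right)A$. The hypotheses on the integrals include that these integrals exist. Derivatives are taken in the normed space and equal the componentwise derivatives: $f'=r'+q'A$. $C^1([a,b],\mathbb{R}_{\mathcal{F}(A)})$ is the set of continuously differentiable functions on $[a,b]$ (one-sided derivatives at endpoints). "Almost every(where)" refers to Lebesgue measure. *)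

theory Defs
  imports "HOL-Analysis.Analysis"
begin

text \<open>Fuzzy subsets of the real line are their membership functions; the range condition
  is part of \<open>fuzzy_number\<close>.\<close>

type_synonym fuzzy = "real \<Rightarrow> real"

definition level :: "fuzzy \<Rightarrow> real \<Rightarrow> real set" where
  "level A \<alpha> = (if \<alpha> = 0 then closure {x. A x > 0} else {x. A x \<ge> \<alpha>})"

definition fuzzy_number :: "fuzzy \<Rightarrow> bool" where
  "fuzzy_number A \<longleftrightarrow>
     (\<forall>x. A x \<in> {0..1}) \<and>
     (\<forall>\<alpha>\<in>{0..1}. \<exists>c d. c \<le> d \<and> level A \<alpha> = {c..d}) \<and>
     bounded {x. A x > 0}"

definition asymmetric :: "fuzzy \<Rightarrow> bool" where
  "asymmetric A \<longleftrightarrow> (\<forall>x. \<exists>y. A (x - y) \<noteq> A (x + y))"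

text \<open>\<open>lin A r q\<close> is \<open>r + qA\<close>; \<open>lin A r 0\<close> is the crisp real number \<open>r\<close>.  The description is
  proper by \<open>lin_eq\<close> and \<open>lin_properties\<close> below.\<close>

definition lin :: "fuzzy \<Rightarrow> real \<Rightarrow> real \<Rightarrow> fuzzy" where
  "lin A r q = (THE B. fuzzy_number B \<and>
     (\<forall>\<alpha>\<in>{0..1}. level B \<alpha> = (\<lambda>x. r + q * x) ` level A \<alpha>))"

definition RF :: "fuzzy \<Rightarrow> fuzzy set" where
  "RF A = {lin A r q | r q. True}"

text \<open>The coordinates \<open>r\<^sub>B\<close>, \<open>q\<^sub>B\<close> of \<open>B = r\<^sub>B + q\<^sub>B A\<close>; meaningful for \<open>B \<in> RF A\<close> with \<open>A\<close> an
  asymmetric fuzzy number, see \<open>lin_inject\<close>.\<close>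

definition r_coord :: "fuzzy \<Rightarrow> fuzzy \<Rightarrow> real" where
  "r_coord A B = fst (inv (\<lambda>(r, q). lin A r q) B)"

definition q_coord :: "fuzzy \<Rightarrow> fuzzy \<Rightarrow> real" where
  "q_coord A B = snd (inv (\<lambda>(r, q). lin A r q) B)"

definition fadd :: "fuzzy \<Rightarrow> fuzzy \<Rightarrow> fuzzy \<Rightarrow> fuzzy" where
  "fadd A B C = lin A (r_coord A B + r_coord A C) (q_coord A B + q_coord A C)"

definition fscale :: "fuzzy \<Rightarrow> real \<Rightarrow> fuzzy \<Rightarrow> fuzzy" where
  "fscale A k B = lin A (k * r_coord A B) (k * q_coord A B)"

definition fdiff :: "fuzzy \<Rightarrow> fuzzy \<Rightarrow> fuzzy \<Rightarrow> fuzzy" where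
  "fdiff A B C = fadd A B (fscale A (-1) C)"

definition fzero :: "fuzzy \<Rightarrow> fuzzy" where
  "fzero A = lin A 0 0"

text \<open>The point \<open>b\<close> with \<open>[B]\<^sub>1 = {b}\<close>, if the 1-level is a singleton.\<close>

definition core :: "fuzzy \<Rightarrow> real" where
  "core B = (THE b. level B 1 = {b})"

definition fnorm :: "fuzzy \<Rightarrow> fuzzy \<Rightarrow> real" where
  "fnorm A B = \<bar>q_coord A B\<bar> + \<bar>r_coord A B + q_coord A B * core A\<bar>"

definition cross :: "fuzzy \<Rightarrow> fuzzy \<Rightarrow> fuzzy \<Rightarrow> fuzzy" where
  "cross A B C = fadd A (fadd A (fscale A (core C) B) (fscale A (core B) C))
                        (lin A (- (core B * core C)) 0)"

definition RF0 :: "fuzzy \<Rightarrow> fuzzy set" where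
  "RF0 A = {B \<in> RF A. cross A B B = fzero A}"

text \<open>Differentiation and continuity in the normed space \<open>RF A\<close>, relative to a set \<open>S\<close> (so
  one-sided at the endpoints of an interval).\<close>

definition has_fderiv :: "fuzzy \<Rightarrow> (real \<Rightarrow> fuzzy) \<Rightarrow> fuzzy \<Rightarrow> real set \<Rightarrow> real \<Rightarrow> bool" where
  "has_fderiv A f D S t \<longleftrightarrow> D \<in> RF A \<and>
     ((\<lambda>s. fnorm A (fdiff A (fscale A (1 / (s - t)) (fdiff A (f s) (f t))) D)) \<longlongrightarrow> 0)
       (at t within S)"

definition fdifferentiable :: "fuzzy \<Rightarrow> (real \<Rightarrow> fuzzy) \<Rightarrow> real set \<Rightarrow> real \<Rightarrow> bool" where
  "fdifferentiable A f S t \<longleftrightarrow> (\<exists>D. has_fderiv A f D S t)"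

definition fderiv :: "fuzzy \<Rightarrow> (real \<Rightarrow> fuzzy) \<Rightarrow> real set \<Rightarrow> real \<Rightarrow> fuzzy" where
  "fderiv A f S t = (THE D. has_fderiv A f D S t)"

definition fcontinuous_on :: "fuzzy \<Rightarrow> real set \<Rightarrow> (real \<Rightarrow> fuzzy) \<Rightarrow> bool" where
  "fcontinuous_on A S f \<longleftrightarrow>
     (\<forall>t\<in>S. ((\<lambda>s. fnorm A (fdiff A (f s) (f t))) \<longlongrightarrow> 0) (at t within S))"

definition C1 :: "fuzzy \<Rightarrow> real \<Rightarrow> real \<Rightarrow> (real \<Rightarrow> fuzzy) set" where
  "C1 A a b = {\<eta>. \<eta> \<in> {a..b} \<rightarrow> RF A \<and> (\<forall>t\<in>{a..b}. fdifferentiable A \<eta> {a..b} t) \<and>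
                 fcontinuous_on A {a..b} (fderiv A \<eta> {a..b})}"

text \<open>Riemann integral.  The Riemann sum over a tagged division adds up the terms
  \<open>\<bar>K\<bar> \<cdot> f t\<close>, with \<open>\<bar>K\<bar>\<close> the length of \<open>K\<close>, in the vector space \<open>RF A\<close>; the order is irrelevant, see \<open>riemann_sum_eq\<close>.  In contrast to the gauges of \<open>has_integral\<close>, the mesh bound
  \<open>\<delta>\<close> is a constant.\<close>

definition riemann_sum :: "fuzzy \<Rightarrow> (real \<Rightarrow> fuzzy) \<Rightarrow> (real \<times> real set) set \<Rightarrow> fuzzy" where
  "riemann_sum A f p =
     Finite_Set.fold (\<lambda>(t, K) S. fadd A (fscale A (measure lborel K) (f t)) S) (fzero A) p"

definition has_riemann_integral ::
    "fuzzy \<Rightarrow> (real \<Rightarrow> fuzzy) \<Rightarrow> fuzzy \<Rightarrow> real \<Rightarrow> real \<Rightarrow> bool" where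
  "has_riemann_integral A f I a b \<longleftrightarrow> I \<in> RF A \<and>
     (\<forall>\<epsilon>>0. \<exists>\<delta>>0. \<forall>p. p tagged_division_of {a..b} \<longrightarrow> (\<forall>(t, K)\<in>p. measure lborel K < \<delta>) \<longrightarrow>
        fnorm A (fdiff A (riemann_sum A f p) I) < \<epsilon>)"

lemma fuzzy_eqI:
  assumes "\<And>\<alpha>. 0 < \<alpha> \<Longrightarrow> \<alpha> \<le> 1 \<Longrightarrow> level B \<alpha> = level C \<alpha>"
    and "\<And>x. B x \<in> {0..1}" "\<And>x. C x \<in> {0..1}"
  shows "B = C"
proof
  fix x
  have le: "D x \<le> E x" if lev: "\<And>\<alpha>. 0 < \<alpha> \<Longrightarrow> \<alpha> \<le> 1 \<Longrightarrow> level D \<alpha> = level E \<alpha>"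
    and D: "D x \<in> {0..1}" and E: "E x \<in> {0..1}" for D E :: fuzzy
  proof (cases "D x > 0")
    case True
    have "x \<in> level D (D x)" using True by (simp add: level_def)
    moreover have "level D (D x) = level E (D x)" using lev True D by simp
    ultimately have "x \<in> level E (D x)" by simp
    then show ?thesis using True by (simp add: level_def)
  next
    case False
    then show ?thesis using D E by simp
  qed
  show "B x = C x" using le[of B C] le[of C B] assms by (simp add: order_antisym)
qed

lemma level_affine:
  fixes r q :: real
  assumes "q \<noteq> 0"
  shows "level (\<lambda>x. A ((x - r) / q)) \<alpha> = (\<lambda>x. r + q * x) ` level A \<alpha>"
proof -
  have img: "{x. P ((x - r) / q)} = (\<lambda>x. r + q * x) ` {x. P x}" for P
  proof
    show "{x. P ((x - r) / q)} \<subseteq> (\<lambda>x. r + q * x) ` {x. P x}"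
    proof
      fix x
      assume "x \<in> {x. P ((x - r) / q)}"
      moreover have "x = r + q * ((x - r) / q)" using assms by simp
      ultimately show "x \<in> (\<lambda>x. r + q * x) ` {x. P x}" by blast
    qed
  qed (use assms in auto)
  have cl: "closure ((\<lambda>x. r + q * x) ` S) = (\<lambda>x. r + q * x) ` closure S" for S
  proof -
    have "(\<lambda>x. r + q * x) ` T = (+) r ` ((*\<^sub>R) q ` T)" for T :: "real set"
      by (auto simp: image_image)
    then show ?thesis by (simp only: closure_translation closure_scaleR)
  qed
  show ?thesis
    using img[of "\<lambda>x. A x > 0"] img[of "\<lambda>x. A x \<ge> \<alpha>"] cl by (simp add: level_def)
qed

lemma affine_image_Icc:
  fixes c d r q :: real
  assumes "c \<le> d"
  shows "(\<lambda>x. r + q * x) ` {c..d} = {min (r + q * c) (r + q * d)..max (r + q * c) (r + q * d)}"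
proof (cases "q \<ge> 0")
  case True
  then have "q * c \<le> q * d" using assms by (rule mult_left_mono[rotated])
  then show ?thesis using True assms image_affinity_atLeastAtMost[of q r c d]
    by (simp add: add.commute)
next
  case False
  then have "q * d \<le> q * c" using assms by (intro mult_left_mono_neg) auto
  then show ?thesis using False assms image_affinity_atLeastAtMost[of q r c d]
    by (simp add: add.commute min_def max_def)
qed

lemma lin_aux:
  assumes A: "fuzzy_number A"
  defines "B \<equiv> (\<lambda>r q x. if q = 0 then (if x = r then 1 else 0) else A ((x - r) / q))"
  shows "fuzzy_number (B r q) \<and>
     (\<forall>\<alpha>\<in>{0..1}. level (B r q) \<alpha> = (\<lambda>x. r + q * x) ` level A \<alpha>)"
proof -
  have lev: "level (B r q) \<alpha> = (\<lambda>x. r + q * x) ` level A \<alpha>" if "\<alpha> \<in> {0..1}" for \<alpha>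
  proof (cases "q = 0")
    case True
    have "level A \<alpha> \<noteq> {}" using A that by (fastforce simp: fuzzy_number_def)
    moreover have "{x. 0 < (if x = r then 1 else 0 :: real)} = {r}" by auto
    ultimately have "level (B r q) \<alpha> = {r}"
      using True that by (auto simp: B_def level_def split: if_splits)
    also have "\<dots> = (\<lambda>x. r + q * x) ` level A \<alpha>"
      using True \<open>level A \<alpha> \<noteq> {}\<close> by auto
    finally show ?thesis .
  next
    case False
    then show ?thesis using level_affine[OF False] by (simp add: B_def)
  qed
  have "\<exists>c d. c \<le> d \<and> level (B r q) \<alpha> = {c..d}" if \<alpha>: "\<alpha> \<in> {0..1}" for \<alpha>
  proof -
    obtain c d where cd: "c \<le> d" "level A \<alpha> = {c..d}"
      using A \<alpha> unfolding fuzzy_number_def by blast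
    have "level (B r q) \<alpha> = {min (r + q * c) (r + q * d)..max (r + q * c) (r + q * d)}"
      using lev[OF \<alpha>] cd affine_image_Icc by simp
    then show ?thesis by (meson max.cobounded1 min.cobounded1 order_trans)
  qed
  note int = this
  moreover have "bounded {x. B r q x > 0}"
  proof -
    obtain c d where "level (B r q) 0 = {c..d}" using int[of 0] by auto
    then have "{x. B r q x > 0} \<subseteq> {c..d}"
      using closure_subset[of "{x. B r q x > 0}"] by (simp add: level_def)
    then show ?thesis using bounded_subset bounded_closed_interval by blast
  qed
  moreover have "B r q x \<in> {0..1}" for x
    using A by (auto simp: B_def fuzzy_number_def)
  ultimately show ?thesis using lev by (auto simp: fuzzy_number_def)
qed

lemma lin_eq:
  assumes "fuzzy_number A"
  shows "lin A r q = (\<lambda>x. if q = 0 then (if x = r then 1 else 0) else A ((x - r) / q))"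
  unfolding lin_def
proof (rule the_equality)
  fix B
  assume B: "fuzzy_number B \<and> (\<forall>\<alpha>\<in>{0..1}. level B \<alpha> = (\<lambda>x. r + q * x) ` level A \<alpha>)"
  show "B = (\<lambda>x. if q = 0 then (if x = r then 1 else 0) else A ((x - r) / q))"
    by (rule fuzzy_eqI)
      (use B lin_aux[OF assms, of q r] in \<open>auto simp: fuzzy_number_def\<close>)
qed (rule lin_aux[OF assms])

lemma lin_properties:
  assumes "fuzzy_number A"
  shows "fuzzy_number (lin A r q)"
    and "\<alpha> \<in> {0..1} \<Longrightarrow> level (lin A r q) \<alpha> = (\<lambda>x. r + q * x) ` level A \<alpha>"
  using lin_aux[OF assms, of q r] lin_eq[OF assms, of r q] by simp_all

lemma lin_inject:
  assumes A: "fuzzy_number A" and asym: "asymmetric A"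
  shows "lin A r q = lin A r' q' \<longleftrightarrow> r = r' \<and> q = q'"
proof
  assume eq: "lin A r q = lin A r' q'"
  obtain c d where cd: "c \<le> d" "level A 0 = {c..d}"
    using A unfolding fuzzy_number_def by (metis atLeastAtMost_iff order_refl zero_le_one)
  have supp: "x \<in> {c..d}" if "A x \<noteq> 0" for x
  proof -
    have "A x > 0" using that A by (auto simp: fuzzy_number_def less_le)
    then have "x \<in> level A 0"
      using closure_subset[of "{x. A x > 0}"] by (auto simp: level_def)
    then show ?thesis using cd by simp
  qed
  have "c \<noteq> d"
  proof
    assume "c = d"
    then have "A z = 0" if "z \<noteq> c" for z using supp[of z] that by fastforce
    then have "A (c - y) = A (c + y)" for y by (cases "y = 0") simp_all
    then show False using asym by (auto simp: asymmetric_def)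
  qed
  then have cd': "c < d" using cd by simp
  have lv: "(\<lambda>x. r + q * x) ` {c..d} = (\<lambda>x. r' + q' * x) ` {c..d}"
    using lin_properties(2)[OF A, of 0] cd eq by (metis atLeastAtMost_iff order_refl zero_le_one)
  have mm: "min (r + q * c) (r + q * d) = min (r' + q' * c) (r' + q' * d)"
    "max (r + q * c) (r + q * d) = max (r' + q' * c) (r' + q' * d)"
    using lv cd affine_image_Icc by (auto simp: Icc_eq_Icc)
  then have "(r + q * c = r' + q' * c \<and> r + q * d = r' + q' * d) \<or>
    (r + q * c = r' + q' * d \<and> r + q * d = r' + q' * c)"
    by (auto simp: min_def max_def split: if_splits)
  then show "r = r' \<and> q = q'"
  proof
    assume *: "r + q * c = r' + q' * c \<and> r + q * d = r' + q' * d"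
    then have "(q - q') * (d - c) = 0" by (simp add: algebra_simps)
    then show ?thesis using cd' * by auto
  next
    assume *: "r + q * c = r' + q' * d \<and> r + q * d = r' + q' * c"
    then have "(q + q') * (d - c) = 0" by (simp add: algebra_simps)
    then have q: "q' = - q" using cd' by auto
    show ?thesis
    proof (cases "q = 0")
      case True
      then show ?thesis using q * by auto
    next
      case False
      have "A ((x - r) / q) = A ((x - r') / q')" for x
        using fun_cong[OF eq, of x] lin_eq[OF A] False q by simp
      note e = this
      have sym: "A z = A ((r' - r) / q - z)" for z
      proof -
        have "(r + q * z - r') / q' = (r' - r) / q - z"
          using False q by (simp add: field_simps)
        then show ?thesis using e[of "r + q * z"] False by simp
      qed
      have "A (m - y) = A (m + y)" if "m = (r' - r) / q / 2" for m y
        using sym[of "m - y"] that by (simp add: algebra_simps)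
      then show ?thesis using asym unfolding asymmetric_def by blast
    qed
  qed
qed simp

lemma coord_lin:
  assumes "fuzzy_number A" "asymmetric A"
  shows "r_coord A (lin A r q) = r" "q_coord A (lin A r q) = q"
proof -
  have "inj (\<lambda>(r, q). lin A r q)"
    using lin_inject[OF assms] by (auto simp: inj_def)
  then have "inv (\<lambda>(r, q). lin A r q) (lin A r q) = (r, q)"
    by (rule inv_f_eq) simp
  then show "r_coord A (lin A r q) = r" "q_coord A (lin A r q) = q"
    by (simp_all add: r_coord_def q_coord_def)
qed

lemma core_lin:
  assumes "fuzzy_number A" "level A 1 = {m}"
  shows "core (lin A r q) = r + q * m"
  using lin_properties(2)[OF assms(1), of 1 r q] assms(2) by (simp add: core_def)

lemma cross_lin:
  assumes "fuzzy_number A" "asymmetric A" "level A 1 = {m}"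
  shows "cross A (lin A r q) (lin A r' q') =
    lin A (r * r' - m\<^sup>2 * q * q') (r * q' + r' * q + 2 * m * q * q')"
  by (simp add: cross_def fadd_def fscale_def coord_lin[OF assms(1,2)] core_lin[OF assms(1,3)]
      lin_inject[OF assms(1,2)] algebra_simps power2_eq_square)

lemma RF0_eq:
  assumes "fuzzy_number A" "asymmetric A" "level A 1 = {m}"
  shows "RF0 A = {lin A r q | r q. r + q * m = 0}"
proof -
  have "r * r - m\<^sup>2 * q * q = 0 \<and> r * q + r * q + 2 * m * q * q = 0 \<longleftrightarrow> r + q * m = 0" for r q
  proof
    assume *: "r * r - m\<^sup>2 * q * q = 0 \<and> r * q + r * q + 2 * m * q * q = 0"
    have "(r + q * m)\<^sup>2 = (r * r - m\<^sup>2 * q * q) + m * (r * q + r * q + 2 * m * q * q)"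
      by (simp add: power2_eq_square algebra_simps)
    then show "r + q * m = 0" using * by simp
  next
    assume "r + q * m = 0"
    then have "r = - (q * m)" by simp
    then show "r * r - m\<^sup>2 * q * q = 0 \<and> r * q + r * q + 2 * m * q * q = 0"
      by (simp add: power2_eq_square algebra_simps)
  qed
  then show ?thesis
    unfolding RF0_def RF_def fzero_def
    by (auto simp: cross_lin[OF assms] lin_inject[OF assms(1,2)])
qed

lemma riemann_sum_eq:
  assumes "fuzzy_number A" "asymmetric A" "finite p"
  shows "riemann_sum A f p =
    lin A (\<Sum>(t, K)\<in>p. measure lborel K * r_coord A (f t))
          (\<Sum>(t, K)\<in>p. measure lborel K * q_coord A (f t))"
proof -
  define g where "g = (\<lambda>(t, K :: real set) S. fadd A (fscale A (measure lborel K) (f t)) S)"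
  have g_pair: "g (t, K) S = lin A (measure lborel K * r_coord A (f t) + r_coord A S)
      (measure lborel K * q_coord A (f t) + q_coord A S)" for t K S
    by (simp add: g_def fadd_def fscale_def coord_lin[OF assms(1,2)])
  interpret comp_fun_commute g
  proof
    show "g y \<circ> g x = g x \<circ> g y" for x y
      by (auto simp: g_def fun_eq_iff fadd_def fscale_def coord_lin[OF assms(1,2)]
          add_ac split: prod.splits)
  qed
  have "Finite_Set.fold g (fzero A) p =
    lin A (\<Sum>(t, K)\<in>p. measure lborel K * r_coord A (f t))
          (\<Sum>(t, K)\<in>p. measure lborel K * q_coord A (f t))"
    using assms(3)
    by (induction p rule: finite_induct)
      (auto simp: fzero_def g_pair coord_lin[OF assms(1,2)])
  then show ?thesis by (simp add: riemann_sum_def g_def)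
qed

end

theory Submission
  imports Defs
begin

text \<open>In the coordinates \<open>core_coord\<close> \<open>c = r + q a\<^sub>m\<close> and \<open>q_coord\<close> \<open>q\<close> the cross product reads
  \<open>(c, q) (c', q') = (c c', q c' + c q')\<close>, so \<open>RF A\<close> is the ring of dual numbers and \<open>RF0 A\<close> is its
  ideal \<open>c = 0\<close>.  A crisp test function \<open>\<eta>\<close>, one whose values are real numbers, has a crisp
  derivative \<open>h\<close>, and multiplication by \<open>h\<close> only scales both coordinates.  Every continuous real \<open>h\<close>
  with integral \<open>0\<close> arises in this way (\<open>crisp_primitive\<close>).  Testing with crisp functions alone
  therefore shows that \<open>\<integral> c h = 0\<close> for all such \<open>h\<close> in part (i), and that \<open>\<integral> c h = \<integral> q h = 0\<close> in part (ii)
  (\<open>crisp_test_functions\<close>).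

  What remains is a real lemma of du Bois-Reymond.  Differentiability almost everywhere gives
  continuity almost everywhere, which allows a pointwise argument: if \<open>\<phi>\<close> is continuous
  at \<open>x\<close> and at \<open>y\<close> with \<open>\<phi> x < \<phi> y\<close>, then a tent around \<open>y\<close> minus a tent around \<open>x\<close>, weighted to have
  mean zero, pairs with \<open>\<phi>\<close> to a positive number
  (\<open>orthogonal_to_mean_zero_imp_le\<close>).  So \<open>\<phi>\<close> takes a single value at all its points of
  continuity.\<close>

section \<open>The lemma of du Bois-Reymond at points of continuity\<close>

lemma tent_integral_pos:
  fixes a b d x :: real
  assumes "a < b" "0 < d" "x \<in> {a..b}"
  shows "0 < integral {a..b} (\<lambda>t. max 0 (d - \<bar>t - x\<bar>))"
proof -
  let ?T = "\<lambda>t. max 0 (d - \<bar>t - x\<bar>)"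
  have cont: "continuous_on {a..b} ?T" by (intro continuous_intros)
  have "integral {a..b} ?T \<ge> 0" by (intro integral_nonneg integrable_continuous_real cont) auto
  moreover have "integral {a..b} ?T \<noteq> 0"
    using integral_eq_0_iff[OF cont \<open>a < b\<close>] assms(2,3) by force
  ultimately show ?thesis by linarith
qed

text \<open>Suppose that \<open>\<phi> x < \<phi> y\<close> and choose a level \<open>M\<close> strictly between these values.  For a mean-zero
  \<open>h\<close> the integral of \<open>(\<phi> - M) h\<close> vanishes as well.  If \<open>h\<close> is positive only near \<open>y\<close>, where
  \<open>\<phi> > M\<close>, and negative only near \<open>x\<close>, where \<open>\<phi> < M\<close>, then the integrand is nonnegative and bounded
  below by a multiple of the tent around \<open>y\<close>, a contradiction.  The points may be endpoints of
  the interval, since half a tent has positive integral too.\<close>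

lemma orthogonal_to_mean_zero_imp_le:
  fixes \<phi> :: "real \<Rightarrow> real"
  assumes "a < b"
    and orth: "\<And>h. continuous_on {a..b} h \<Longrightarrow> (h has_integral 0) {a..b} \<Longrightarrow>
           ((\<lambda>t. \<phi> t * h t) has_integral 0) {a..b}"
    and x: "x \<in> {a..b}" "continuous (at x within {a..b}) \<phi>"
    and y: "y \<in> {a..b}" "continuous (at y within {a..b}) \<phi>"
  shows "\<phi> y \<le> \<phi> x"
proof (rule ccontr)
  assume "\<not> \<phi> y \<le> \<phi> x"
  then have less: "\<phi> x < \<phi> y" by simp
  define e where "e = (\<phi> y - \<phi> x) / 4"
  define M where "M = \<phi> x + 2 * e"
  have e: "e > 0" using less by (simp add: e_def)
  have My: "\<phi> y = M + 2 * e" by (simp add: M_def e_def field_simps)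
  obtain d1 where d1: "d1 > 0" "\<And>t. t \<in> {a..b} \<Longrightarrow> \<bar>t - x\<bar> < d1 \<Longrightarrow> \<bar>\<phi> t - \<phi> x\<bar> < e"
    using x(2) e unfolding continuous_within_eps_delta dist_real_def by blast
  obtain d2 where d2: "d2 > 0" "\<And>t. t \<in> {a..b} \<Longrightarrow> \<bar>t - y\<bar> < d2 \<Longrightarrow> \<bar>\<phi> t - \<phi> y\<bar> < e"
    using y(2) e unfolding continuous_within_eps_delta dist_real_def by blast
  define X where "X = (\<lambda>t. max 0 (d1 - \<bar>t - x\<bar>))"
  define Y where "Y = (\<lambda>t. max 0 (d2 - \<bar>t - y\<bar>))"
  define cx where "cx = integral {a..b} X"
  define cy where "cy = integral {a..b} Y"
  have pos: "cx > 0" "cy > 0"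
    unfolding cx_def cy_def X_def Y_def using tent_integral_pos assms(1) x(1) y(1) d1(1) d2(1) by auto
  have contX: "continuous_on {a..b} X" and contY: "continuous_on {a..b} Y"
    unfolding X_def Y_def by (intro continuous_intros)+
  have intX: "(X has_integral cx) {a..b}" and intY: "(Y has_integral cy) {a..b}"
    unfolding cx_def cy_def using contX contY integrable_continuous_real integrable_integral by blast+
  \<comment> \<open>Each tent is weighted by the integral of the other one, so that the difference has mean
    zero even if a tent is cut off by an endpoint.\<close>
  define h where "h = (\<lambda>t. cx * Y t - cy * X t)"
  have int_h: "(h has_integral 0) {a..b}"
    using has_integral_diff[OF has_integral_mult_right[OF intY, of cx]
        has_integral_mult_right[OF intX, of cy]]
    by (simp add: h_def mult.commute)
  have "continuous_on {a..b} h"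
    unfolding h_def by (intro continuous_intros contX contY)
  then have "((\<lambda>t. \<phi> t * h t - M * h t) has_integral 0 - M * 0) {a..b}"
    by (intro has_integral_diff has_integral_mult_right orth int_h)
  note upper = this
  have lower: "((\<lambda>t. e * cx * Y t) has_integral e * cx * cy) {a..b}"
    by (intro has_integral_mult_right intY)
  have "e * cx * Y t \<le> \<phi> t * h t - M * h t" if t: "t \<in> {a..b}" for t
  proof -
    have "e * (cx * Y t) \<le> (\<phi> t - M) * (cx * Y t)"
    proof (cases "\<bar>t - y\<bar> < d2")
      case True
      then have "e \<le> \<phi> t - M" using d2(2)[OF t] My by fastforce
      then show ?thesis using pos by (intro mult_right_mono) (auto simp: Y_def)
    qed (simp add: Y_def)
    moreover have "(\<phi> t - M) * (cy * X t) \<le> 0"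
    proof (cases "\<bar>t - x\<bar> < d1")
      case True
      then have "\<phi> t - M \<le> 0" using d1(2)[OF t] M_def e by fastforce
      then show ?thesis using pos by (intro mult_nonpos_nonneg) (auto simp: X_def)
    qed (simp add: X_def)
    ultimately show ?thesis by (simp add: h_def algebra_simps)
  qed
  then have "e * cx * cy \<le> 0 - M * 0" by (rule has_integral_le[OF lower upper])
  then show False using e pos by (simp add: mult_le_0_iff)
qed

text \<open>All points of continuity share one value, and almost every point is a point of continuity.\<close>

lemma du_bois_reymond_AE:
  fixes \<phi> :: "real \<Rightarrow> real"
  assumes "a < b"
    and orth: "\<And>h. continuous_on {a..b} h \<Longrightarrow> (h has_integral 0) {a..b} \<Longrightarrow>
           ((\<lambda>t. \<phi> t * h t) has_integral 0) {a..b}"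
    and cont: "AE t in lebesgue. t \<in> {a..b} \<longrightarrow> continuous (at t within {a..b}) \<phi>"
  shows "\<exists>k. AE t in lebesgue. t \<in> {a..b} \<longrightarrow> \<phi> t = k"
proof (cases "\<exists>x\<in>{a..b}. continuous (at x within {a..b}) \<phi>")
  case True
  then obtain x where x: "x \<in> {a..b}" "continuous (at x within {a..b}) \<phi>" by blast
  have eq: "\<phi> t = \<phi> x" if "t \<in> {a..b}" "continuous (at t within {a..b}) \<phi>" for t
    using orthogonal_to_mean_zero_imp_le[OF assms(1) orth] x that by (meson order_antisym)
  then have "AE t in lebesgue. t \<in> {a..b} \<longrightarrow> \<phi> t = \<phi> x"
    using cont by eventually_elim (use eq in blast)
  then show ?thesis by blast
next
  case False
  \<comment> \<open>Without points of continuity the hypothesis makes the interval null, and every constant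
    will do.\<close>
  then have "AE t in lebesgue. t \<in> {a..b} \<longrightarrow> \<phi> t = 0"
    using cont by eventually_elim (use False in blast)
  then show ?thesis by blast
qed

section \<open>Calculus in coordinates\<close>

text \<open>For \<open>B\<close> in \<open>RF A\<close> this is the point \<open>core B\<close>.  It is defined from the coordinates of \<open>B\<close> instead
  of its 1-level because this makes it compatible with \<open>fdiff\<close> and \<open>fscale\<close> for arbitrary arguments, and then \<open>fnorm\<close> is the sum norm of
  the pair \<open>(q_coord, core_coord)\<close>.\<close>

definition core_coord :: "fuzzy \<Rightarrow> fuzzy \<Rightarrow> real" where
  "core_coord A B = r_coord A B + q_coord A B * core A"

lemma RF_eqI:
  assumes "fuzzy_number A" "asymmetric A" "B \<in> RF A" "C \<in> RF A"
    and "core_coord A B = core_coord A C" "q_coord A B = q_coord A C"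
  shows "B = C"
  using assms by (auto simp: RF_def core_coord_def coord_lin)

lemma core_level:
  "level A 1 = {m} \<Longrightarrow> core A = m"
  by (simp add: core_def)

lemma coord_fdiff:
  assumes "fuzzy_number A" "asymmetric A"
  shows "q_coord A (fdiff A B C) = q_coord A B - q_coord A C"
    and "core_coord A (fdiff A B C) = core_coord A B - core_coord A C"
  by (simp_all add: fdiff_def fadd_def fscale_def core_coord_def coord_lin[OF assms] algebra_simps)

lemma coord_fscale:
  assumes "fuzzy_number A" "asymmetric A"
  shows "q_coord A (fscale A k B) = k * q_coord A B"
    and "core_coord A (fscale A k B) = k * core_coord A B"
  by (simp_all add: fscale_def core_coord_def coord_lin[OF assms] algebra_simps)

lemma fnorm_coord: "fnorm A B = \<bar>q_coord A B\<bar> + \<bar>core_coord A B\<bar>"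
  by (simp add: fnorm_def core_coord_def)

text \<open>This equivalence reduces limits, hence continuity and derivatives, in \<open>RF A\<close> to limits of the two
  real coordinates.\<close>

lemma fnorm_tendsto_0_iff:
  "((\<lambda>s. fnorm A (B s)) \<longlongrightarrow> 0) F \<longleftrightarrow>
     ((\<lambda>s. q_coord A (B s)) \<longlongrightarrow> 0) F \<and> ((\<lambda>s. core_coord A (B s)) \<longlongrightarrow> 0) F"
proof
  assume *: "((\<lambda>s. fnorm A (B s)) \<longlongrightarrow> 0) F"
  show "((\<lambda>s. q_coord A (B s)) \<longlongrightarrow> 0) F \<and> ((\<lambda>s. core_coord A (B s)) \<longlongrightarrow> 0) F"
    using Lim_null_comparison[OF _ *, of "\<lambda>s. q_coord A (B s)"]
      Lim_null_comparison[OF _ *, of "\<lambda>s. core_coord A (B s)"]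
    by (simp add: fnorm_coord)
next
  assume "((\<lambda>s. q_coord A (B s)) \<longlongrightarrow> 0) F \<and> ((\<lambda>s. core_coord A (B s)) \<longlongrightarrow> 0) F"
  then show "((\<lambda>s. fnorm A (B s)) \<longlongrightarrow> 0) F"
    unfolding fnorm_coord using tendsto_add_zero tendsto_rabs_zero by blast
qed

lemma has_fderiv_iff:
  assumes "fuzzy_number A" "asymmetric A"
  shows "has_fderiv A f D S t \<longleftrightarrow> D \<in> RF A \<and>
     ((\<lambda>s. q_coord A (f s)) has_field_derivative q_coord A D) (at t within S) \<and>
     ((\<lambda>s. core_coord A (f s)) has_field_derivative core_coord A D) (at t within S)"
  by (simp add: has_fderiv_def fnorm_tendsto_0_iff coord_fdiff[OF assms] coord_fscale[OF assms]
      has_field_derivative_iff LIM_zero_iff)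

lemma fdifferentiable_imp_continuous_coords:
  assumes "fuzzy_number A" "asymmetric A" "fdifferentiable A f S t"
  shows "continuous (at t within S) (\<lambda>s. q_coord A (f s))"
    and "continuous (at t within S) (\<lambda>s. core_coord A (f s))"
  using assms(3) unfolding fdifferentiable_def has_fderiv_iff[OF assms(1,2)]
  by (auto intro: DERIV_continuous)

lemma fderiv_eq:
  assumes "fuzzy_number A" "asymmetric A" "has_fderiv A f D {a..b} t" "a < b" "t \<in> {a..b}"
  shows "fderiv A f {a..b} t = D"
  unfolding fderiv_def
proof (rule the_equality)
  fix E assume E: "has_fderiv A f E {a..b} t"
  have nt: "at t within {a..b} \<noteq> bot"
    using assms(4,5) by (simp add: trivial_limit_within islimpt_Icc)
  show "E = D"
  proof (rule RF_eqI[OF assms(1,2)])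
    show "core_coord A E = core_coord A D" "q_coord A E = q_coord A D"
      using E assms(3) tendsto_unique[OF nt]
      unfolding has_fderiv_iff[OF assms(1,2)] has_field_derivative_iff by blast+
  qed (use E assms(3) in \<open>auto simp: has_fderiv_def\<close>)
qed (rule assms(3))

text \<open>The Riemann integral is the special case of the gauge integral with a constant gauge: the
  intervals of a division that is fine for balls of radius \<open>\<delta> / 4\<close> have length at most \<open>\<delta> / 2\<close>.\<close>

lemma has_integral_of_uniform_mesh:
  fixes g :: "real \<Rightarrow> real"
  assumes "\<And>\<epsilon>. \<epsilon> > 0 \<Longrightarrow> \<exists>\<delta>>0. \<forall>p. p tagged_division_of {a..b} \<longrightarrow>
      (\<forall>(t, K)\<in>p. measure lborel K < \<delta>) \<longrightarrow> \<bar>(\<Sum>(t, K)\<in>p. measure lborel K * g t) - I\<bar> < \<epsilon>"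
  shows "(g has_integral I) {a..b}"
  unfolding has_integral_real
proof (intro allI impI)
  fix \<epsilon> :: real assume "\<epsilon> > 0"
  then obtain \<delta> where \<delta>: "\<delta> > 0" "\<And>p. p tagged_division_of {a..b} \<Longrightarrow>
      (\<forall>(t, K)\<in>p. measure lborel K < \<delta>) \<Longrightarrow> \<bar>(\<Sum>(t, K)\<in>p. measure lborel K * g t) - I\<bar> < \<epsilon>"
    using assms by metis
  let ?\<gamma> = "\<lambda>t. ball t (\<delta> / 4) :: real set"
  have "measure lborel K < \<delta>"
    if p: "p tagged_division_of {a..b}" "?\<gamma> fine p" and K: "(t, K) \<in> p" for p t K
  proof -
    have "K \<subseteq> cball t (\<delta> / 4)" using fineD[OF p(2) K] by force
    obtain u v where uv: "K = cbox u v" using tagged_division_ofD(4)[OF p(1) K] by blast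
    have "measure lborel K \<le> measure lborel (cbox (t - \<delta> / 4) (t + \<delta> / 4))"
      unfolding uv by (rule content_subset) (use \<open>K \<subseteq> cball t (\<delta> / 4)\<close> uv in \<open>simp add: cball_eq_atLeastAtMost\<close>)
    also have "\<dots> < \<delta>" using \<open>\<delta> > 0\<close> by (simp add: content_real)
    finally show ?thesis .
  qed
  then have "norm ((\<Sum>(t, K)\<in>p. measure lborel K *\<^sub>R g t) - I) < \<epsilon>"
    if "p tagged_division_of {a..b}" "?\<gamma> fine p" for p
    using \<delta>(2)[OF that(1)] that by (fastforce simp: split_beta)
  moreover have "gauge ?\<gamma>" using \<delta>(1) by (simp add: gauge_ball)
  ultimately show "\<exists>\<gamma>. gauge \<gamma> \<and> (\<forall>\<D>. \<D> tagged_division_of {a..b} \<and> \<gamma> fine \<D> \<longrightarrow>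
      norm ((\<Sum>(x, k)\<in>\<D>. measure lborel k *\<^sub>R g x) - I) < \<epsilon>)"
    by blast
qed

lemma has_riemann_integral_coords:
  assumes A: "fuzzy_number A" "asymmetric A" and int: "has_riemann_integral A g I a b"
  shows "((\<lambda>t. q_coord A (g t)) has_integral q_coord A I) {a..b}"
    and "((\<lambda>t. core_coord A (g t)) has_integral core_coord A I) {a..b}"
proof -
  have sums: "q_coord A (riemann_sum A g p) = (\<Sum>(t, K)\<in>p. measure lborel K * q_coord A (g t))"
    "core_coord A (riemann_sum A g p) = (\<Sum>(t, K)\<in>p. measure lborel K * core_coord A (g t))"
    if "p tagged_division_of {a..b}" for p
    using tagged_division_of_finite[OF that]
    by (simp_all add: riemann_sum_eq[OF A] core_coord_def coord_lin[OF A] sum_distrib_left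
        sum.distrib[symmetric] split_beta algebra_simps)
  have close: "\<exists>\<delta>>0. \<forall>p. p tagged_division_of {a..b} \<longrightarrow>
      (\<forall>(t, K)\<in>p. measure lborel K < \<delta>) \<longrightarrow>
      \<bar>(\<Sum>(t, K)\<in>p. measure lborel K * q_coord A (g t)) - q_coord A I\<bar> < \<epsilon> \<and>
      \<bar>(\<Sum>(t, K)\<in>p. measure lborel K * core_coord A (g t)) - core_coord A I\<bar> < \<epsilon>"
    if \<epsilon>: "\<epsilon> > 0" for \<epsilon>
  proof -
    obtain \<delta> where "\<delta> > 0" and \<delta>: "\<And>p. p tagged_division_of {a..b} \<Longrightarrow>
      (\<forall>(t, K)\<in>p. measure lborel K < \<delta>) \<Longrightarrow> fnorm A (fdiff A (riemann_sum A g p) I) < \<epsilon>"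
      using int \<epsilon> unfolding has_riemann_integral_def by metis
    have "\<bar>(\<Sum>(t, K)\<in>p. measure lborel K * q_coord A (g t)) - q_coord A I\<bar> < \<epsilon>"
      "\<bar>(\<Sum>(t, K)\<in>p. measure lborel K * core_coord A (g t)) - core_coord A I\<bar> < \<epsilon>"
      if p: "p tagged_division_of {a..b}" "\<forall>(t, K)\<in>p. measure lborel K < \<delta>" for p
      using \<delta>[OF p] unfolding fnorm_coord coord_fdiff[OF A] sums[OF p(1)] by linarith+
    then show ?thesis using \<open>\<delta> > 0\<close> by blast
  qed
  show "((\<lambda>t. q_coord A (g t)) has_integral q_coord A I) {a..b}"
    by (rule has_integral_of_uniform_mesh, drule close, elim exE conjE, intro exI conjI, assumption)
      simp
  show "((\<lambda>t. core_coord A (g t)) has_integral core_coord A I) {a..b}"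
    by (rule has_integral_of_uniform_mesh, drule close, elim exE conjE, intro exI conjI, assumption)
      simp
qed

section \<open>Crisp test functions\<close>

lemma coord_crisp:
  assumes "fuzzy_number A" "asymmetric A"
  shows "q_coord A (lin A r 0) = 0" "core_coord A (lin A r 0) = r"
  by (simp_all add: core_coord_def coord_lin[OF assms])

text \<open>A crisp factor acts as a scalar.  This decouples the two coordinates in the cross product.\<close>

lemma coord_cross_crisp:
  assumes "fuzzy_number A" "asymmetric A" "level A 1 = {m}" "B \<in> RF A"
  shows "q_coord A (cross A B (lin A k 0)) = q_coord A B * k"
    and "core_coord A (cross A B (lin A k 0)) = core_coord A B * k"
  using assms(4)
  by (auto simp: RF_def cross_lin[OF assms(1-3)] core_coord_def coord_lin[OF assms(1,2)]
      algebra_simps)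

text \<open>The test function is the primitive of \<open>h\<close> from \<open>a\<close>; it vanishes at \<open>b\<close> because \<open>h\<close> has mean zero.\<close>

lemma crisp_primitive:
  assumes A: "fuzzy_number A" "asymmetric A" and "a < b"
    and cont: "continuous_on {a..b} h" and h0: "(h has_integral 0) {a..b}"
  obtains \<eta> where "\<eta> \<in> C1 A a b" "\<eta> a = fzero A" "\<eta> b = fzero A"
    "\<And>t. t \<in> {a..b} \<Longrightarrow> fderiv A \<eta> {a..b} t = lin A (h t) 0"
proof
  let ?\<eta> = "\<lambda>t. lin A (integral {a..t} h) 0"
  have deriv: "has_fderiv A ?\<eta> (lin A (h t) 0) {a..b} t" if "t \<in> {a..b}" for t
    using integral_has_real_derivative[OF cont that]
    by (auto simp: has_fderiv_iff[OF A] coord_crisp[OF A] RF_def)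
  show fd: "fderiv A ?\<eta> {a..b} t = lin A (h t) 0" if "t \<in> {a..b}" for t
    by (rule fderiv_eq[OF A deriv \<open>a < b\<close>]) (use that in auto)
  have "((\<lambda>s. fnorm A (fdiff A (fderiv A ?\<eta> {a..b} s) (fderiv A ?\<eta> {a..b} t))) \<longlongrightarrow> 0)
      (at t within {a..b})" if t: "t \<in> {a..b}" for t
  proof -
    have "((\<lambda>s. fnorm A (fdiff A (lin A (h s) 0) (lin A (h t) 0))) \<longlongrightarrow> 0) (at t within {a..b})"
      using cont t by (simp add: fnorm_tendsto_0_iff coord_fdiff[OF A] coord_crisp[OF A]
          continuous_on_def LIM_zero_iff)
    then show ?thesis
      by (rule Lim_transform_within[OF _ zero_less_one]) (use t fd in auto)
  qed
  then show "?\<eta> \<in> C1 A a b"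
    using deriv unfolding C1_def RF_def fdifferentiable_def fcontinuous_on_def by blast
  show "?\<eta> a = fzero A" "?\<eta> b = fzero A"
    using h0 by (simp_all add: fzero_def integral_unique)
qed

text \<open>The set \<open>S\<close> of admissible values of the integral covers both parts of the theorem: it is
  \<open>RF0 A\<close> in one and \<open>{fzero A}\<close> in the other.\<close>

lemma crisp_test_functions:
  fixes h :: "real \<Rightarrow> real"
  assumes A: "fuzzy_number A" "asymmetric A" "level A 1 = {m}" and "a < b"
    and f: "f \<in> {a..b} \<rightarrow> RF A"
    and int: "\<And>\<eta>. \<eta> \<in> C1 A a b \<Longrightarrow> \<eta> a = fzero A \<Longrightarrow> \<eta> b = fzero A \<Longrightarrow> \<exists>I \<in> S.
        has_riemann_integral A (\<lambda>t. cross A (f t) (fderiv A \<eta> {a..b} t)) I a b"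
    and h: "continuous_on {a..b} h" "(h has_integral 0) {a..b}"
  shows "\<exists>I \<in> S. ((\<lambda>t. q_coord A (f t) * h t) has_integral q_coord A I) {a..b} \<and>
           ((\<lambda>t. core_coord A (f t) * h t) has_integral core_coord A I) {a..b}"
proof -
  obtain \<eta> where \<eta>: "\<eta> \<in> C1 A a b" "\<eta> a = fzero A" "\<eta> b = fzero A"
    and deriv: "\<And>t. t \<in> {a..b} \<Longrightarrow> fderiv A \<eta> {a..b} t = lin A (h t) 0"
    using crisp_primitive[OF A(1,2) \<open>a < b\<close> h] by blast
  obtain I where I: "I \<in> S"
    "has_riemann_integral A (\<lambda>t. cross A (f t) (fderiv A \<eta> {a..b} t)) I a b"
    using int[OF \<eta>] by blast
  have prod: "q_coord A (cross A (f t) (fderiv A \<eta> {a..b} t)) = q_coord A (f t) * h t"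
    "core_coord A (cross A (f t) (fderiv A \<eta> {a..b} t)) = core_coord A (f t) * h t"
    if "t \<in> {a..b}" for t
    using coord_cross_crisp[OF A] f that deriv[OF that] by (auto simp: Pi_iff)
  show ?thesis
    using I(1) has_integral_eq[OF prod(1) has_riemann_integral_coords(1)[OF A(1,2) I(2)]]
      has_integral_eq[OF prod(2) has_riemann_integral_coords(2)[OF A(1,2) I(2)]] by blast
qed

lemma core_coord_RF0:
  assumes "fuzzy_number A" "asymmetric A" "level A 1 = {m}" "B \<in> RF A"
  shows "B \<in> RF0 A \<longleftrightarrow> core_coord A B = 0"
  using assms(4)
  by (auto simp: RF_def RF0_eq[OF assms(1-3)] core_coord_def coord_lin[OF assms(1,2)]
      core_level[OF assms(3)] lin_inject[OF assms(1,2)])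

theorem corollary4:
  fixes A :: fuzzy and a_m a b :: real
  assumes "fuzzy_number A" and "asymmetric A" and "level A 1 = {a_m}" and "a < b"
  shows
    "(\<forall>f \<in> {a..b} \<rightarrow> RF A.
        (AE t in lebesgue. t \<in> {a..b} \<longrightarrow> fdifferentiable A f {a..b} t) \<longrightarrow>
        (\<forall>\<eta> \<in> C1 A a b. \<eta> a = fzero A \<and> \<eta> b = fzero A \<longrightarrow>
           (\<exists>I \<in> RF0 A.
              has_riemann_integral A (\<lambda>t. cross A (f t) (fderiv A \<eta> {a..b} t)) I a b)) \<longrightarrow>
        (\<exists>u \<in> RF A. AE t in lebesgue. t \<in> {a..b} \<longrightarrow> fdiff A (f t) u \<in> RF0 A)) \<and>
     (\<forall>f \<in> {a..b} \<rightarrow> RF A.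
        (AE t in lebesgue. t \<in> {a..b} \<longrightarrow> fdifferentiable A f {a..b} t) \<longrightarrow>
        (\<forall>\<eta> \<in> C1 A a b. \<eta> a = fzero A \<and> \<eta> b = fzero A \<longrightarrow>
           has_riemann_integral A (\<lambda>t. cross A (f t) (fderiv A \<eta> {a..b} t)) (fzero A) a b) \<longrightarrow>
        (\<exists>u \<in> RF A. AE t in lebesgue. t \<in> {a..b} \<longrightarrow> f t = u))"
proof (intro conjI ballI impI)
  note A = assms(1,2)
  fix f assume f: "f \<in> {a..b} \<rightarrow> RF A"
    and diff: "AE t in lebesgue. t \<in> {a..b} \<longrightarrow> fdifferentiable A f {a..b} t"
    and int: "\<forall>\<eta> \<in> C1 A a b. \<eta> a = fzero A \<and> \<eta> b = fzero A \<longrightarrow> (\<exists>I \<in> RF0 A.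
      has_riemann_integral A (\<lambda>t. cross A (f t) (fderiv A \<eta> {a..b} t)) I a b)"
  have cont: "AE t in lebesgue. t \<in> {a..b} \<longrightarrow>
      continuous (at t within {a..b}) (\<lambda>t. core_coord A (f t))"
    using diff by eventually_elim (blast intro: fdifferentiable_imp_continuous_coords[OF A])
  have orth: "((\<lambda>t. core_coord A (f t) * h t) has_integral 0) {a..b}"
    if h: "continuous_on {a..b} h" "(h has_integral 0) {a..b}" for h :: "real \<Rightarrow> real"
  proof -
    obtain I where "I \<in> RF0 A"
      "((\<lambda>t. core_coord A (f t) * h t) has_integral core_coord A I) {a..b}"
      using crisp_test_functions[OF assms f _ h, of "RF0 A"] int by blast
    moreover from this(1) have "core_coord A I = 0"
      using core_coord_RF0[OF assms(1-3)] by (auto simp: RF0_def)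
    ultimately show ?thesis by simp
  qed
  obtain k where k: "AE t in lebesgue. t \<in> {a..b} \<longrightarrow> core_coord A (f t) = k"
    using du_bois_reymond_AE[OF \<open>a < b\<close> orth cont] by blast
  have RF0: "fdiff A B (lin A k 0) \<in> RF0 A" if "core_coord A B = k" for B
  proof -
    have "fdiff A B (lin A k 0) \<in> RF A" by (auto simp: fdiff_def fadd_def RF_def)
    then show ?thesis
      using that by (simp add: core_coord_RF0[OF assms(1-3)] coord_fdiff[OF A] coord_crisp[OF A])
  qed
  from k have "AE t in lebesgue. t \<in> {a..b} \<longrightarrow> fdiff A (f t) (lin A k 0) \<in> RF0 A"
    by eventually_elim (use RF0 in blast)
  then show "\<exists>u \<in> RF A. AE t in lebesgue. t \<in> {a..b} \<longrightarrow> fdiff A (f t) u \<in> RF0 A"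
    by (auto simp: RF_def)
next
  note A = assms(1,2)
  fix f assume f: "f \<in> {a..b} \<rightarrow> RF A"
    and diff: "AE t in lebesgue. t \<in> {a..b} \<longrightarrow> fdifferentiable A f {a..b} t"
    and int: "\<forall>\<eta> \<in> C1 A a b. \<eta> a = fzero A \<and> \<eta> b = fzero A \<longrightarrow>
      has_riemann_integral A (\<lambda>t. cross A (f t) (fderiv A \<eta> {a..b} t)) (fzero A) a b"
  have cont: "AE t in lebesgue. t \<in> {a..b} \<longrightarrow>
      continuous (at t within {a..b}) (\<lambda>t. q_coord A (f t))"
    "AE t in lebesgue. t \<in> {a..b} \<longrightarrow>
      continuous (at t within {a..b}) (\<lambda>t. core_coord A (f t))"
    using diff by (eventually_elim, blast intro: fdifferentiable_imp_continuous_coords[OF A])+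
  have orth: "((\<lambda>t. q_coord A (f t) * h t) has_integral 0) {a..b}"
    "((\<lambda>t. core_coord A (f t) * h t) has_integral 0) {a..b}"
    if h: "continuous_on {a..b} h" "(h has_integral 0) {a..b}" for h :: "real \<Rightarrow> real"
    using crisp_test_functions[OF assms f _ h, of "{fzero A}"] int
    by (auto simp: fzero_def coord_crisp[OF A])
  obtain q where q: "AE t in lebesgue. t \<in> {a..b} \<longrightarrow> q_coord A (f t) = q"
    using du_bois_reymond_AE[OF \<open>a < b\<close> orth(1) cont(1)] by blast
  obtain k where k: "AE t in lebesgue. t \<in> {a..b} \<longrightarrow> core_coord A (f t) = k"
    using du_bois_reymond_AE[OF \<open>a < b\<close> orth(2) cont(2)] by blast
  \<comment> \<open>The real part is chosen to make the core coordinate of \<open>u\<close> equal to \<open>k\<close>.\<close>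
  define u where "u = lin A (k - q * core A) q"
  have u: "u \<in> RF A" "core_coord A u = k" "q_coord A u = q"
    by (auto simp: u_def RF_def core_coord_def coord_lin[OF A])
  from k q have "AE t in lebesgue. t \<in> {a..b} \<longrightarrow> f t = u"
  proof eventually_elim
    case (elim t)
    then show ?case using f u by (auto intro!: RF_eqI[OF A])
  qed
  with u(1) show "\<exists>u \<in> RF A. AE t in lebesgue. t \<in> {a..b} \<longrightarrow> f t = u" by blast
qed

end
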